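(* Let $n$ be a positive integer and let $W_n=\mathrm{Der}(\mathbb{C}[t_1^{\pm1},\dots,t_n^{\pm1}])$ be the Witt algebra. Then every local derivation on $W_n$ is a derivation of the Lie algebra $W_n$.
   Context: All algebras are over $\mathbb{C}$. $W_n$ is the Lie algebra of all $\mathbb{C}$-linear derivations of the Laurent polynomial algebra $A_n=\mathbb{C}[t_1^{\pm1},\dots,t_n^{\pm1}]$, with the commutator bracket. Concretely $W_n=\bigoplus_{i=1}^n A_n d_i$ with $d_i=t_i\frac{\partial}{\partial t_i}$ and $[t^\alpha d_i,t^\beta d_j]=\beta_i t^{\alpha+\beta}d_j-\alpha_j t^{\alpha+\beta}d_i$ for $\alpha,\beta\in\mathbb{Z}^n$, where $t^\alpha=t_1^{\alpha_1}\cdots t_n^{\alpha_n}$. A derivation on a Lie algebra $L$ is a linear map $D:L\to L$ with $D([x,y])=[D(x),y]+[x,D(y)]$ for all $x,y\in L$. A local derivation on $L$ is a linear map $\Delta:L\to L$ such that for every $x\in L$ there exists a derivation $D_x:L\to L$ (depending on $x$) with $\Delta(x)=D_x(x)$. *)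

theory Defs
  imports "HOL-Library.Poly_Mapping" "HOL-Analysis.Finite_Cartesian_Product"
begin

locale lie_algebra = vector_space scale
  for scale :: "complex \<Rightarrow> 'a::ab_group_add \<Rightarrow> 'a" +
  fixes bracket :: "'a \<Rightarrow> 'a \<Rightarrow> 'a"
  assumes bracket_add_left: "bracket (x + y) z = bracket x z + bracket y z"
    and bracket_add_right: "bracket x (y + z) = bracket x y + bracket x z"
    and bracket_scale_left: "bracket (scale c x) y = scale c (bracket x y)"
    and bracket_scale_right: "bracket x (scale c y) = scale c (bracket x y)"
    and bracket_self: "bracket x x = 0"
    and jacobi: "bracket x (bracket y z) + bracket y (bracket z x) + bracket z (bracket x y) = 0"
begin

definition derivation :: "('a \<Rightarrow> 'a) \<Rightarrow> bool" where
  "derivation D \<longleftrightarrow> Vector_Spaces.linear scale scale D \<and>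
     (\<forall>x y. D (bracket x y) = bracket (D x) y + bracket x (D y))"

definition local_derivation :: "('a \<Rightarrow> 'a) \<Rightarrow> bool" where
  "local_derivation \<Delta> \<longleftrightarrow> Vector_Spaces.linear scale scale \<Delta> \<and>
     (\<forall>x. \<exists>D. derivation D \<and> \<Delta> x = D x)"

end

text \<open>The Laurent polynomial algebra in variables indexed by \<open>'n\<close> is the group algebra of
  the exponent group \<open>int ^ 'n\<close>; the monomial with exponent vector \<open>\<alpha>\<close> is
  \<open>Poly_Mapping.single \<alpha> 1\<close>, and multiplication is the convolution product of
  \<open>Poly_Mapping\<close>.\<close>

type_synonym 'n laurent = "(int ^ 'n) \<Rightarrow>\<^sub>0 complex"

definition lscale :: "complex \<Rightarrow> 'n::finite laurent \<Rightarrow> 'n laurent" where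
  "lscale c p = Poly_Mapping.map ((*) c) p"

lemma lookup_lscale [simp]: "Poly_Mapping.lookup (lscale c p) \<alpha> = c * Poly_Mapping.lookup p \<alpha>"
  by (simp add: lscale_def Poly_Mapping.map.rep_eq when_def)

lemma lscale_eq_single: "lscale c p = Poly_Mapping.single 0 c * p"
  unfolding lscale_def by (simp add: mult_map_scale_conv_mult)

lemma lscale_mult_left: "lscale c p * q = lscale c (p * q)"
  by (simp add: lscale_eq_single mult.assoc)

lemma lscale_mult_right: "p * lscale c q = lscale c (p * q)"
  by (simp add: lscale_eq_single mult.left_commute)

lemma lscale_minus: "lscale c (- p) = - lscale c p"
  by (simp add: lscale_eq_single)

lemma lscale_diff: "lscale c (p - q) = lscale c p - lscale c q"
  by (simp add: lscale_eq_single algebra_simps)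

global_interpretation laurent: vector_space "lscale :: complex \<Rightarrow> 'n::finite laurent \<Rightarrow> 'n laurent"
  by unfold_locales (auto intro!: poly_mapping_eqI simp: lookup_add algebra_simps)

definition laurent_derivation :: "('n::finite laurent \<Rightarrow> 'n laurent) \<Rightarrow> bool" where
  "laurent_derivation D \<longleftrightarrow> Vector_Spaces.linear lscale lscale D \<and>
     (\<forall>p q. D (p * q) = D p * q + p * D q)"

lemma laurent_derivation_iff:
  "laurent_derivation D \<longleftrightarrow> (\<forall>p q. D (p + q) = D p + D q) \<and>
     (\<forall>c p. D (lscale c p) = lscale c (D p)) \<and> (\<forall>p q. D (p * q) = D p * q + p * D q)"
  by (auto simp: laurent_derivation_def Vector_Spaces.linear_iff laurent.vector_space_axioms)

typedef (overloaded) 'n witt = "{D :: 'n::finite laurent \<Rightarrow> 'n laurent. laurent_derivation D}"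
  morphisms act Abs_witt
  by (rule exI [of _ "\<lambda>_. 0"]) (simp add: laurent_derivation_iff)

setup_lifting type_definition_witt

instantiation witt :: (finite) ab_group_add
begin

lift_definition zero_witt :: "'a witt" is "\<lambda>_. 0"
  by (simp add: laurent_derivation_iff)

lift_definition plus_witt :: "'a witt \<Rightarrow> 'a witt \<Rightarrow> 'a witt" is "\<lambda>D E p. D p + E p"
  by (simp add: laurent_derivation_iff laurent.scale_right_distrib algebra_simps)

lift_definition uminus_witt :: "'a witt \<Rightarrow> 'a witt" is "\<lambda>D p. - D p"
  by (simp add: laurent_derivation_iff lscale_minus)

lift_definition minus_witt :: "'a witt \<Rightarrow> 'a witt \<Rightarrow> 'a witt" is "\<lambda>D E p. D p - E p"
  by (simp add: laurent_derivation_iff lscale_diff algebra_simps)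

instance
  by standard (transfer; simp add: fun_eq_iff algebra_simps)+

end

lift_definition wscale :: "complex \<Rightarrow> 'n::finite witt \<Rightarrow> 'n witt" is "\<lambda>c D p. lscale c (D p)"
  by (simp add: laurent_derivation_iff laurent.scale_right_distrib laurent.scale_left_commute
      lscale_mult_left lscale_mult_right)

lift_definition wbracket :: "'n::finite witt \<Rightarrow> 'n witt \<Rightarrow> 'n witt" is
  "\<lambda>D E p. D (E p) - E (D p)"
  by (simp add: laurent_derivation_iff lscale_diff algebra_simps)

lemma act_derivation: "laurent_derivation (act D)"
  using act by blast

lemma act_add: "act D (p + q) = act D p + act D q"
  and act_scale: "act D (lscale c p) = lscale c (act D p)"
  and act_mult: "act D (p * q) = act D p * q + p * act D q"
  using act_derivation [of D] by (auto simp: laurent_derivation_iff)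

lemma act_diff: "act D (p - q) = act D p - act D q"
  by (metis act_add diff_add_cancel eq_diff_eq)

lemma witt_eqI: "(\<And>p. act D p = act E p) \<Longrightarrow> D = E"
  by (metis act_inject ext)

global_interpretation witt: lie_algebra "wscale :: complex \<Rightarrow> 'n::finite witt \<Rightarrow> 'n witt" wbracket
  by unfold_locales
    (auto intro!: witt_eqI simp: plus_witt.rep_eq zero_witt.rep_eq wscale.rep_eq wbracket.rep_eq
      act_add act_scale act_diff lscale_diff laurent.scale_right_distrib laurent.scale_left_distrib
      algebra_simps)

end

theory Submission
  imports Defs "HOL-Analysis.Cartesian_Space" "HOL-Analysis.Continuum_Not_Denumerable"
    "HOL-Computational_Algebra.Polynomial"
begin

text \<open>
  Write \<open>d_u = \<Sum> u_i d_i\<close>, so that \<open>p d_u\<close> is \<open>vf p u\<close>, and fix \<open>v\<close> such that \<open>\<gamma> \<mapsto> \<langle>v, \<gamma>\<rangle>\<close> is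
  injective on exponents.  Comparing eigenspaces of \<open>ad d_v\<close> shows that every derivation is inner;
  hence a local derivation \<open>\<Delta>\<close> satisfies \<open>\<Delta> x \<in> [W, x]\<close> for every \<open>x\<close>.  After subtracting an inner
  derivation, \<open>\<Delta> d_v = 0\<close>, and then \<open>\<Delta> d_u = 0\<close> for all \<open>u\<close>, since the coefficient of \<open>\<Delta> d_u\<close> at \<open>t^\<alpha>\<close>
  is linear in \<open>u\<close> and vanishes both at \<open>v\<close> and where \<open>\<langle>u, \<alpha>\<rangle> = 0\<close>.

  Now \<open>\<Delta> (t^\<alpha> d_u) = \<Delta> ((t^\<alpha> - s) d_u)\<close> lies in \<open>[W, (t^\<alpha> - s) d_u]\<close> for every scalar \<open>s\<close>.
  Evaluating at an arbitrary point \<open>\<rho>\<close> of the torus, with \<open>s = \<rho>(\<alpha>)\<close>, kills the factor \<open>t^\<alpha> - s\<close>; the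
  surviving identities hold at all points of the torus and force \<open>\<Delta> (t^\<alpha> d_u) = c(\<alpha>) t^\<alpha> d_u\<close>.
  Finally \<open>x = t^\<alpha> (t^\<beta> - 1)^2 d_u\<close> vanishes to second order at the identity of the torus, so
  the symbol of \<open>\<Delta> x \<in> [W, x]\<close> vanishes there, which says \<open>c(\<alpha> + 2\<beta>) - 2 c(\<alpha> + \<beta>) + c(\<alpha>) = 0\<close>.
  As \<open>c(0) = 0\<close>, the function \<open>c\<close> is additive and \<open>\<Delta>\<close> is the bracket with some \<open>d_w\<close>.
\<close>

section \<open>Vector fields and their symbols\<close>

abbreviation tmon :: "int ^ 'n \<Rightarrow> 'n::finite laurent"
  where "tmon \<gamma> \<equiv> Poly_Mapping.single \<gamma> 1"

lemma lscale_add: "lscale c (p + q) = lscale c p + lscale c q"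
  by (simp add: lscale_eq_single algebra_simps)

lemma lscale_zero [simp]: "lscale c 0 = 0" "lscale 0 p = 0"
  by (simp_all add: lscale_eq_single)

lemma lscale_one [simp]: "lscale 1 p = p"
  by (simp add: lscale_eq_single)

lemma lscale_lscale [simp]: "lscale a (lscale b p) = lscale (a * b) p"
  by (simp add: poly_mapping_eqI)

lemma lscale_single [simp]: "lscale c (Poly_Mapping.single \<gamma> a) = Poly_Mapping.single \<gamma> (c * a)"
  by (simp add: lscale_eq_single mult_single)

lemma tmon_mult [simp]: "tmon \<alpha> * tmon \<beta> = tmon (\<alpha> + \<beta>)"
  by (simp add: mult_single)

lemma tmon_cancel [simp]: "tmon \<alpha> * (tmon (- \<alpha>) * p) = p" "tmon (- \<alpha>) * (tmon \<alpha> * p) = p"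
  by (simp_all add: mult.assoc [symmetric])

lemma laurent_induct [case_names zero single add]:
  assumes "P 0"
    and "\<And>\<gamma> c. P (Poly_Mapping.single \<gamma> c)"
    and "\<And>p q. P p \<Longrightarrow> P q \<Longrightarrow> P (p + q)"
  shows "P (p :: 'n::finite laurent)"
proof (induction p rule: update_induct)
  case const
  show ?case by fact
next
  case (update f a b)
  have "Poly_Mapping.update a b f = f + Poly_Mapping.single a b"
    using update(1)
    by (intro poly_mapping_eqI)
      (auto simp: lookup_update lookup_add lookup_single when_def in_keys_iff)
  then show ?case
    using update assms by simp
qed

lemma lookup_tmon_mult:
  "Poly_Mapping.lookup (tmon \<alpha> * p) \<gamma> = Poly_Mapping.lookup p (\<gamma> - \<alpha>)"
proof (induction p rule: laurent_induct)
  case (single \<beta> c)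
  have "\<alpha> + \<beta> = \<gamma> \<longleftrightarrow> \<beta> = \<gamma> - \<alpha>"
    by (auto simp: algebra_simps)
  then show ?case
    by (simp add: mult_single lookup_single when_def)
qed (simp_all add: lookup_add algebra_simps)

text \<open>Ring values make this usable both for complex functions on exponents and for
  \<open>symb D\<close>, whose values are Laurent polynomials.\<close>

lemma additive_eq_sum_axis:
  fixes c :: "int ^ 'n::finite \<Rightarrow> 'b::ring_1"
  assumes add: "\<And>\<alpha> \<beta>. c (\<alpha> + \<beta>) = c \<alpha> + c \<beta>"
  shows "c \<gamma> = (\<Sum>i\<in>UNIV. of_int (\<gamma> $ i) * c (axis i 1))"
proof -
  interpret additive c
    by unfold_locales (rule add)
  have nat: "c (axis i (int k)) = of_nat k * c (axis i 1)" for i k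
  proof (induction k)
    case (Suc k)
    have "axis i (int (Suc k)) = axis i (int k) + (axis i 1 :: int ^ 'n)"
      by (simp add: vec_eq_iff axis_def)
    then show ?case
      by (simp add: add Suc algebra_simps)
  qed (simp add: zero axis_def flip: zero_vec_def)
  have int: "c (axis i k) = of_int k * c (axis i 1)" for i k
  proof (cases "k \<ge> 0")
    case True
    then show ?thesis
      using nat [of i "nat k"] by simp
  next
    case False
    have "axis i k = - (axis i (- k) :: int ^ 'n)"
      by (simp add: vec_eq_iff axis_def)
    then show ?thesis
      using False nat [of i "nat (- k)"] by (simp add: minus)
  qed
  have "\<gamma> = (\<Sum>i\<in>UNIV. axis i (\<gamma> $ i))"
    by (simp add: vec_eq_iff axis_def)
  then have "c \<gamma> = c (\<Sum>i\<in>UNIV. axis i (\<gamma> $ i))"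
    by (rule arg_cong [of _ _ c])
  also have "\<dots> = (\<Sum>i\<in>UNIV. of_int (\<gamma> $ i) * c (axis i 1))"
    unfolding sum by (intro sum.cong refl int)
  finally show ?thesis .
qed

section \<open>Pairing of complex vectors with exponents\<close>

definition pairing :: "complex ^ 'n \<Rightarrow> int ^ 'n \<Rightarrow> complex"
  where "pairing u \<gamma> = (\<Sum>i\<in>UNIV. u $ i * of_int (\<gamma> $ i))"

lemma pairing_add_left: "pairing (u + w) \<gamma> = pairing u \<gamma> + pairing w \<gamma>"
  and pairing_add_right: "pairing u (\<alpha> + \<beta>) = pairing u \<alpha> + pairing u \<beta>"
  and pairing_diff_left: "pairing (u - w) \<gamma> = pairing u \<gamma> - pairing w \<gamma>"
  and pairing_diff_right: "pairing u (\<alpha> - \<beta>) = pairing u \<alpha> - pairing u \<beta>"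
  and pairing_minus_right: "pairing u (- \<alpha>) = - pairing u \<alpha>"
  and pairing_scale_left: "pairing (c *s u) \<gamma> = c * pairing u \<gamma>"
  by (simp_all add: pairing_def algebra_simps sum.distrib sum_subtractf sum_negf sum_distrib_left)

lemma pairing_scale_right: "pairing u (k *s \<gamma>) = of_int k * pairing u \<gamma>"
  by (simp add: pairing_def sum_distrib_left algebra_simps)

lemma pairing_zero [simp]: "pairing u 0 = 0" "pairing 0 \<gamma> = 0"
  by (simp_all add: pairing_def)

lemma pairing_axis_right [simp]: "pairing u (axis i 1) = u $ i"
proof -
  have "pairing u (axis i 1) = (\<Sum>j\<in>UNIV. if j = i then u $ j else 0)"
    unfolding pairing_def by (rule sum.cong) (auto simp: axis_def)
  then show ?thesis
    by simp
qed

lemma pairing_axis_left [simp]: "pairing (axis i 1) \<gamma> = of_int (\<gamma> $ i)"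
proof -
  have "pairing (axis i 1) \<gamma> = (\<Sum>j\<in>UNIV. if j = i then of_int (\<gamma> $ j) else 0)"
    unfolding pairing_def by (rule sum.cong) (auto simp: axis_def)
  then show ?thesis
    by simp
qed

lemma pairing_eqI: "(\<And>\<gamma>. pairing u \<gamma> = pairing w \<gamma>) \<Longrightarrow> u = w"
  by (metis pairing_axis_right vec_eq_iff)

lemma additive_eq_pairing:
  fixes c :: "int ^ 'n::finite \<Rightarrow> complex"
  assumes "\<And>\<alpha> \<beta>. c (\<alpha> + \<beta>) = c \<alpha> + c \<beta>"
  shows "c \<gamma> = pairing (\<chi> i. c (axis i 1)) \<gamma>"
  using additive_eq_sum_axis [of c \<gamma>] assms by (simp add: pairing_def mult.commute)

text \<open>This is the operator \<open>d_u\<close> on Laurent polynomials: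
  \<open>t^\<gamma>\<close> is an eigenvector with eigenvalue
  \<open>\<langle>u, \<gamma>\<rangle>\<close>.\<close>

definition grad :: "complex ^ 'n \<Rightarrow> 'n::finite laurent \<Rightarrow> 'n laurent"
  where "grad u p = Poly_Mapping.mapp (\<lambda>\<gamma> a. pairing u \<gamma> * a) p"

lemma lookup_grad [simp]:
  "Poly_Mapping.lookup (grad u p) \<gamma> = pairing u \<gamma> * Poly_Mapping.lookup p \<gamma>"
  by (simp add: grad_def lookup_mapp when_def in_keys_iff)

lemma grad_add: "grad u (p + q) = grad u p + grad u q"
  and grad_diff: "grad u (p - q) = grad u p - grad u q"
  and grad_lscale: "grad u (lscale c p) = lscale c (grad u p)"
  and grad_zero [simp]: "grad u 0 = 0"
  and grad_single: "grad u (Poly_Mapping.single \<gamma> c) = Poly_Mapping.single \<gamma> (pairing u \<gamma> * c)"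
  by (auto intro!: poly_mapping_eqI simp: lookup_add lookup_minus lookup_single when_def algebra_simps)

lemma grad_mult: "grad u (p * q) = grad u p * q + p * grad u q"
proof (induction p rule: laurent_induct)
  case (single \<alpha> a)
  show ?case
  proof (induction q rule: laurent_induct)
    case (single \<beta> b)
    show ?case
      by (simp add: mult_single grad_single pairing_add_right algebra_simps flip: single_add)
  qed (simp_all add: grad_add algebra_simps)
qed (simp_all add: grad_add algebra_simps)

section \<open>Vector fields \<open>p d_u\<close> and symbols\<close>

lift_definition vf :: "'n::finite laurent \<Rightarrow> complex ^ 'n \<Rightarrow> 'n witt" is "\<lambda>p u q. p * grad u q"
  by (simp add: laurent_derivation_iff grad_add grad_lscale grad_mult lscale_mult_right algebra_simps)

lemmas witt_rep_eq = plus_witt.rep_eq minus_witt.rep_eq uminus_witt.rep_eq zero_witt.rep_eq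
  wscale.rep_eq wbracket.rep_eq vf.rep_eq

text \<open>The logarithmic derivative of \<open>t^\<gamma>\<close> along \<open>D\<close>. For
  \<open>D = \<Sum> p_i d_i\<close> it equals \<open>\<Sum> \<gamma>_i p_i\<close>, so the symbols
  at the axis vectors are the coefficients of \<open>D\<close>.\<close>

definition symb :: "'n::finite witt \<Rightarrow> int ^ 'n \<Rightarrow> 'n laurent"
  where "symb D \<gamma> = act D (tmon \<gamma>) * tmon (- \<gamma>)"

lemma act_tmon: "act D (tmon \<gamma>) = tmon \<gamma> * symb D \<gamma>"
  by (simp add: symb_def mult.commute [of _ "tmon (- \<gamma>)"])

lemma act_zero [simp]: "act D 0 = 0"
  using act_diff [of D 0 0] by simp

lemma act_one [simp]: "act D 1 = 0"
  using act_mult [of D 1 1] by simp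

lemma act_single: "act D (Poly_Mapping.single \<gamma> c) = lscale c (tmon \<gamma> * symb D \<gamma>)"
  using act_scale [of D c "tmon \<gamma>"] by (simp add: act_tmon)

lemma act_const [simp]: "act D (Poly_Mapping.single 0 c) = 0"
  by (simp add: act_single symb_def)

lemma symb_add_right: "symb D (\<alpha> + \<beta>) = symb D \<alpha> + symb D \<beta>"
proof -
  have "tmon (\<alpha> + \<beta>) * symb D (\<alpha> + \<beta>) = tmon (\<alpha> + \<beta>) * (symb D \<alpha> + symb D \<beta>)"
    unfolding act_tmon [symmetric] unfolding tmon_mult [symmetric] act_mult
    unfolding act_tmon by (simp add: algebra_simps del: tmon_mult)
  then have "tmon (- (\<alpha> + \<beta>)) * (tmon (\<alpha> + \<beta>) * symb D (\<alpha> + \<beta>))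
    = tmon (- (\<alpha> + \<beta>)) * (tmon (\<alpha> + \<beta>) * (symb D \<alpha> + symb D \<beta>))"
    by (rule arg_cong)
  then show ?thesis
    by (simp only: tmon_cancel)
qed

lemma witt_symb_eqI:
  assumes "\<And>\<gamma>. symb D \<gamma> = symb E \<gamma>"
  shows "D = E"
proof (rule witt_eqI)
  show "act D p = act E p" for p
    by (induction p rule: laurent_induct) (simp_all add: act_single act_add assms)
qed

lemma witt_axis_eqI:
  assumes "\<And>i. symb D (axis i 1) = symb E (axis i 1)"
  shows "D = E"
proof (rule witt_symb_eqI)
  show "symb D \<gamma> = symb E \<gamma>" for \<gamma>
    using additive_eq_sum_axis [of "symb D" \<gamma>] additive_eq_sum_axis [of "symb E" \<gamma>]
    by (simp add: symb_add_right assms)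
qed

lemma symb_add: "symb (D + E) \<gamma> = symb D \<gamma> + symb E \<gamma>"
  and symb_diff: "symb (D - E) \<gamma> = symb D \<gamma> - symb E \<gamma>"
  and symb_zero [simp]: "symb 0 \<gamma> = 0"
  and symb_wscale: "symb (wscale c D) \<gamma> = lscale c (symb D \<gamma>)"
  by (simp_all add: symb_def witt_rep_eq lscale_mult_left lscale_mult_right algebra_simps)

lemma symb_sum: "symb (\<Sum>i\<in>I. f i) \<gamma> = (\<Sum>i\<in>I. symb (f i) \<gamma>)"
  by (induction I rule: infinite_finite_induct) (simp_all add: symb_add)

lemma symb_vf: "symb (vf p u) \<gamma> = lscale (pairing u \<gamma>) p"
proof -
  have "symb (vf p u) \<gamma> = p * (Poly_Mapping.single \<gamma> (pairing u \<gamma>) * tmon (- \<gamma>))"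
    by (simp add: symb_def vf.rep_eq grad_single mult.assoc)
  then show ?thesis
    by (simp add: mult_single lscale_eq_single mult.commute)
qed

text \<open>Applying \<open>D E\<close> to \<open>t^\<gamma>\<close> gives \<open>t^\<gamma>\<close>
  times \<open>symb D \<gamma> * symb E \<gamma> + act D (symb E \<gamma>)\<close>. The product is
  symmetric in \<open>D\<close> and \<open>E\<close> and cancels in the commutator.\<close>

lemma symb_bracket: "symb (wbracket D E) \<gamma> = act D (symb E \<gamma>) - act E (symb D \<gamma>)"
proof -
  have "act D (act E (tmon \<gamma>)) * tmon (- \<gamma>) = symb D \<gamma> * symb E \<gamma> + act D (symb E \<gamma>)" for D E
  proof -
    have "act D (act E (tmon \<gamma>)) = tmon \<gamma> * (symb D \<gamma> * symb E \<gamma> + act D (symb E \<gamma>))"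
      by (simp add: act_tmon act_mult algebra_simps)
    then show ?thesis
      by (simp add: mult.commute [of _ "tmon (- \<gamma>)"])
  qed
  then show ?thesis
    by (simp add: symb_def wbracket.rep_eq algebra_simps symb_def [symmetric])
qed

lemma vf_add_left: "vf (p + q) u = vf p u + vf q u"
  and vf_add_right: "vf p (u + w) = vf p u + vf p w"
  and vf_diff_left: "vf (p - q) u = vf p u - vf q u"
  and vf_diff_right: "vf p (u - w) = vf p u - vf p w"
  and vf_scale_left: "vf (lscale c p) u = wscale c (vf p u)"
  and vf_scale_right: "vf p (c *s u) = wscale c (vf p u)"
  and vf_zero [simp]: "vf 0 u = 0" "vf p 0 = 0"
  by (rule witt_symb_eqI;
      simp add: symb_vf symb_add symb_diff symb_wscale lscale_add lscale_diff mult.commute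
        pairing_add_left pairing_diff_left pairing_scale_left laurent.scale_left_distrib
        laurent.scale_left_diff_distrib)+

lemma vf_bracket:
  "wbracket (vf p u) (vf q w) = vf (p * grad u q) w - vf (q * grad w p) u"
  by (rule witt_symb_eqI)
    (simp add: symb_vf symb_bracket symb_diff vf.rep_eq grad_lscale lscale_mult_right)

lemma symb_sum_vf_axis:
  "symb (\<Sum>i\<in>UNIV. vf (p i) (axis i 1)) (axis j 1) = p j"
proof -
  have "symb (\<Sum>i\<in>UNIV. vf (p i) (axis i 1)) (axis j 1) = (\<Sum>i\<in>UNIV. if i = j then p i else 0)"
    unfolding symb_sum symb_vf pairing_axis_left by (rule sum.cong) (auto simp: axis_def)
  then show ?thesis
    by simp
qed

lemma witt_eq_sum_vf: "D = (\<Sum>i\<in>UNIV. vf (symb D (axis i 1)) (axis i 1))"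
  by (rule witt_axis_eqI) (simp add: symb_sum_vf_axis)

section \<open>Generic vectors and characters\<close>

text \<open>Since \<open>ad d_v\<close> acts on degree \<gamma> as
  \<open>\<langle>v, \<gamma>\<rangle>\<close>, genericity makes its eigenspaces the homogeneous
  components.\<close>

definition generic :: "complex ^ 'n::finite \<Rightarrow> bool"
  where "generic v \<longleftrightarrow> (\<forall>\<gamma>. pairing v \<gamma> = 0 \<longrightarrow> \<gamma> = 0)"

lemma generic_eq_iff: "generic v \<Longrightarrow> pairing v \<alpha> = pairing v \<beta> \<longleftrightarrow> \<alpha> = \<beta>"
  by (metis generic_def pairing_diff_right right_minus_eq)

lemma generic_nonzero: "generic v \<Longrightarrow> v $ i \<noteq> 0"
  by (metis axis_eq_0_iff generic_def pairing_axis_right zero_neq_one)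

text \<open>With \<open>v_i = r ^ e i\<close> for an injective \<open>e\<close>, the pairing with
  \<gamma> is the value at \<open>r\<close> of a polynomial that is nonzero for \<gamma> \<noteq> 0.
  Countably many polynomials have countably many roots, so some real \<open>r\<close> avoids them
  all. Realness later makes \<open>exp (pairing v \<gamma>)\<close> injective in \<gamma>.\<close>

lemma exists_real_generic:
  "\<exists>v :: complex ^ 'n::finite. generic v \<and> (\<forall>\<gamma>. pairing v \<gamma> \<in> \<real>)"
proof -
  obtain e :: "'n \<Rightarrow> nat" where e: "inj e"
    using finite_imp_inj_to_nat_seg [of "UNIV :: 'n set"] by auto
  define P :: "int ^ 'n \<Rightarrow> real poly" where "P \<gamma> = (\<Sum>i\<in>UNIV. monom (of_int (\<gamma> $ i)) (e i))" for \<gamma>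
  have "coeff (P \<gamma>) (e i) = of_int (\<gamma> $ i)" for \<gamma> i
  proof -
    have "coeff (P \<gamma>) (e i) = (\<Sum>j\<in>UNIV. if j = i then of_int (\<gamma> $ j) else 0)"
      unfolding P_def coeff_sum by (rule sum.cong) (auto dest: injD [OF e])
    then show ?thesis
      by simp
  qed
  then have P_nonzero: "P \<gamma> \<noteq> 0" if "\<gamma> \<noteq> 0" for \<gamma>
    using that by (metis coeff_0 of_int_eq_0_iff vec_eq_iff zero_index)
  have "countable (\<Union>\<gamma>\<in>UNIV - {0}. {r. poly (P \<gamma>) r = 0})"
    by (intro countable_UN countableI_type countable_finite poly_roots_finite P_nonzero) simp
  then obtain r where r: "r \<notin> (\<Union>\<gamma>\<in>UNIV - {0}. {r. poly (P \<gamma>) r = 0})"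
    using uncountable_UNIV_real by (metis UNIV_I countable_subset subsetI)
  define v :: "complex ^ 'n" where "v = (\<chi> i. of_real (r ^ e i))"
  have "pairing v \<gamma> = of_real (poly (P \<gamma>) r)" for \<gamma>
    by (simp add: pairing_def v_def P_def poly_sum poly_monom mult.commute)
  then show ?thesis
    using r by (intro exI [of _ v]) (auto simp: generic_def)
qed

section \<open>Characters as points of the torus, and evaluation at them\<close>

definition character :: "(int ^ 'n::finite \<Rightarrow> complex) \<Rightarrow> bool"
  where "character \<rho> \<longleftrightarrow> \<rho> 0 = 1 \<and> (\<forall>\<alpha> \<beta>. \<rho> (\<alpha> + \<beta>) = \<rho> \<alpha> * \<rho> \<beta>)"

definition laurent_eval :: "(int ^ 'n::finite \<Rightarrow> complex) \<Rightarrow> 'n laurent \<Rightarrow> complex"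
  where "laurent_eval \<rho> p = (\<Sum>\<gamma>\<in>Poly_Mapping.keys p. Poly_Mapping.lookup p \<gamma> * \<rho> \<gamma>)"

lemma laurent_eval_superset:
  assumes "finite S" "Poly_Mapping.keys p \<subseteq> S"
  shows "laurent_eval \<rho> p = (\<Sum>\<gamma>\<in>S. Poly_Mapping.lookup p \<gamma> * \<rho> \<gamma>)"
  unfolding laurent_eval_def
  by (rule sum.mono_neutral_left) (use assms in \<open>auto simp: in_keys_iff\<close>)

lemma laurent_eval_zero [simp]: "laurent_eval \<rho> 0 = 0"
  by (simp add: laurent_eval_def)

lemma laurent_eval_single [simp]: "laurent_eval \<rho> (Poly_Mapping.single \<gamma> c) = c * \<rho> \<gamma>"
  by (simp add: laurent_eval_def)

lemma laurent_eval_add: "laurent_eval \<rho> (p + q) = laurent_eval \<rho> p + laurent_eval \<rho> q"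
proof -
  let ?S = "Poly_Mapping.keys p \<union> Poly_Mapping.keys q"
  have "Poly_Mapping.keys (p + q) \<subseteq> ?S"
    by (rule keys_add)
  then show ?thesis
    by (simp add: laurent_eval_superset [of ?S] lookup_add distrib_right sum.distrib)
qed

lemma laurent_eval_lscale: "laurent_eval \<rho> (lscale c p) = c * laurent_eval \<rho> p"
  by (induction p rule: laurent_induct)
    (simp_all add: lscale_add laurent_eval_add algebra_simps)

lemma laurent_eval_minus: "laurent_eval \<rho> (- p) = - laurent_eval \<rho> p"
  using laurent_eval_add [of \<rho> p "- p"] by (simp add: eq_neg_iff_add_eq_0 add.commute)

lemma laurent_eval_diff: "laurent_eval \<rho> (p - q) = laurent_eval \<rho> p - laurent_eval \<rho> q"
  using laurent_eval_add [of \<rho> p "- q"] by (simp add: laurent_eval_minus)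

lemma laurent_eval_mult:
  assumes "character \<rho>"
  shows "laurent_eval \<rho> (p * q) = laurent_eval \<rho> p * laurent_eval \<rho> q"
proof (induction p rule: laurent_induct)
  case (single \<alpha> a)
  show ?case
  proof (induction q rule: laurent_induct)
    case (single \<beta> b)
    show ?case
      using assms by (simp add: mult_single character_def)
  qed (simp_all add: laurent_eval_add algebra_simps)
qed (simp_all add: laurent_eval_add algebra_simps)

text \<open>Vandermonde by elimination: subtracting \<open>x b\<close> times relation m from
  relation m + 1 removes the term of \<open>b\<close> and multiplies the other coefficients by the
  nonzero \<open>x s - x b\<close>.\<close>

lemma power_sums_eq_0_imp_eq_0:
  fixes a x :: "'b \<Rightarrow> 'a::idom"
  assumes "finite S" "inj_on x S" "\<And>m. (\<Sum>s\<in>S. a s * x s ^ m) = 0" "s \<in> S"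
  shows "a s = 0"
  using assms
proof (induction S arbitrary: a s rule: finite_induct)
  case (insert b S)
  have sum_eq: "(\<Sum>s\<in>S. a s * x s ^ m) = - (a b * x b ^ m)" for m
    using insert.prems(2) [of m] insert.hyps by (simp add: eq_neg_iff_add_eq_0 add.commute)
  have "(\<Sum>s\<in>S. a s * (x s - x b) * x s ^ m) = 0" for m
  proof -
    have "(\<Sum>s\<in>S. a s * (x s - x b) * x s ^ m)
        = (\<Sum>s\<in>S. a s * x s ^ Suc m) - x b * (\<Sum>s\<in>S. a s * x s ^ m)"
      by (simp add: sum_distrib_left algebra_simps flip: sum_subtractf)
    then show ?thesis
      unfolding sum_eq by (simp add: algebra_simps)
  qed
  then have "a s * (x s - x b) = 0" if "s \<in> S" for s
    using insert.IH [of "\<lambda>s. a s * (x s - x b)"] insert.prems(1) that by (simp add: inj_on_def)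
  moreover have "x s \<noteq> x b" if "s \<in> S" for s
    using that insert.hyps insert.prems(1) by (auto simp: inj_on_def)
  ultimately have S: "a s = 0" if "s \<in> S" for s
    using that by simp
  then show ?case
    using sum_eq [of 0] insert.prems(3) by auto
qed simp

text \<open>The powers of a single character,
  \<open>\<gamma> \<mapsto> exp (pairing v \<gamma>)\<close> with \<open>v\<close> real and generic,
  suffice: it takes distinct values on distinct exponents, so the evaluations form a Vandermonde
  system.\<close>

lemma laurent_eval_eq_0_imp_eq_0:
  fixes p :: "'n::finite laurent"
  assumes "\<And>\<rho>. character \<rho> \<Longrightarrow> laurent_eval \<rho> p = 0"
  shows "p = 0"
proof -
  obtain v :: "complex ^ 'n" where v: "generic v" and real: "\<And>\<gamma>. pairing v \<gamma> \<in> \<real>"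
    using exists_real_generic by blast
  define x where "x \<gamma> = exp (pairing v \<gamma>)" for \<gamma>
  have "character (\<lambda>\<gamma>. x \<gamma> ^ m)" for m
    by (simp add: character_def x_def pairing_add_right exp_add power_mult_distrib)
  then have sums: "(\<Sum>\<gamma>\<in>Poly_Mapping.keys p. Poly_Mapping.lookup p \<gamma> * x \<gamma> ^ m) = 0" for m
    using assms [of "\<lambda>\<gamma>. x \<gamma> ^ m"] by (simp add: laurent_eval_def)
  have "inj x"
  proof (rule injI)
    fix \<alpha> \<beta>
    assume "x \<alpha> = x \<beta>"
    obtain a b where "pairing v \<alpha> = of_real a" "pairing v \<beta> = of_real b"
      using real by (metis Reals_cases)
    with \<open>x \<alpha> = x \<beta>\<close> have "pairing v \<alpha> = pairing v \<beta>"
      by (simp add: x_def exp_of_real)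
    then show "\<alpha> = \<beta>"
      using generic_eq_iff v by blast
  qed
  then have "Poly_Mapping.lookup p \<gamma> = 0" if "\<gamma> \<in> Poly_Mapping.keys p" for \<gamma>
    using power_sums_eq_0_imp_eq_0 [OF _ _ sums that] by (auto intro: inj_on_subset)
  then show ?thesis
    by (intro poly_mapping_eqI) (metis in_keys_iff lookup_zero)
qed

section \<open>Derivations of the Witt algebra are inner\<close>

lemma witt_linear_iff:
  "Vector_Spaces.linear wscale wscale D \<longleftrightarrow>
    (\<forall>x y. D (x + y) = D x + D y) \<and> (\<forall>c x. D (wscale c x) = wscale c (D x))"
  by (auto simp: Vector_Spaces.linear_iff witt.vector_space_axioms)

lemma witt_derivation_iff:
  "witt.derivation D \<longleftrightarrow>
    (\<forall>x y. D (x + y) = D x + D y) \<and> (\<forall>c x. D (wscale c x) = wscale c (D x)) \<and>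
    (\<forall>x y. D (wbracket x y) = wbracket (D x) y + wbracket x (D y))"
  by (auto simp: witt.derivation_def witt_linear_iff)

lemma witt_bracket_diff_left: "wbracket (x - y) z = wbracket x z - wbracket y z"
  and witt_bracket_diff_right: "wbracket x (y - z) = wbracket x y - wbracket x z"
  by (rule witt_eqI; simp add: witt_rep_eq act_diff)+

lemma witt_bracket_zero [simp]: "wbracket 0 x = 0" "wbracket x 0 = 0"
  by (rule witt_eqI; simp add: witt_rep_eq)+

lemma derivation_wbracket: "witt.derivation (wbracket x)"
  unfolding witt_derivation_iff
  by (auto intro!: witt_eqI simp: witt.bracket_add_right witt.bracket_scale_right
      witt_rep_eq act_diff)

lemma derivation_diff:
  assumes "witt.derivation D" "witt.derivation E"
  shows "witt.derivation (\<lambda>x. D x - E x)"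
  using assms
  by (simp add: witt_derivation_iff witt_bracket_diff_left witt_bracket_diff_right
      witt.scale_right_diff_distrib algebra_simps)

section \<open>Brackets with the Cartan elements \<open>d_u\<close>\<close>

lemma symb_cartan_bracket: "symb (wbracket (vf 1 u) x) \<gamma> = grad u (symb x \<gamma>)"
  by (simp add: symb_bracket symb_vf vf.rep_eq act_scale)

lemma symb_bracket_cartan: "symb (wbracket x (vf 1 u)) \<gamma> = - grad u (symb x \<gamma>)"
  by (simp add: symb_bracket symb_vf vf.rep_eq act_scale)

lemma vf_tmon_bracket:
  "wbracket (vf (tmon \<alpha>) u) (vf (tmon \<beta>) w)
    = vf (tmon (\<alpha> + \<beta>)) (pairing u \<beta> *s w - pairing w \<alpha> *s u)"
  by (simp add: vf_bracket grad_single mult_single vf_diff_right vf_scale_right add.commute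
      flip: vf_scale_left)

lemma vf_cartan_bracket: "wbracket (vf 1 u) (vf (tmon \<alpha>) w) = wscale (pairing u \<alpha>) (vf (tmon \<alpha>) w)"
  by (rule witt_symb_eqI)
    (simp add: symb_cartan_bracket symb_vf symb_wscale grad_single mult.commute)

lemma vf_tmon_inject [simp]: "vf (tmon \<alpha>) u = vf (tmon \<alpha>) w \<longleftrightarrow> u = w"
proof
  assume "vf (tmon \<alpha>) u = vf (tmon \<alpha>) w"
  then have "symb (vf (tmon \<alpha>) u) \<gamma> = symb (vf (tmon \<alpha>) w) \<gamma>" for \<gamma>
    by simp
  then show "u = w"
    by (intro pairing_eqI) (metis lookup_single_eq mult.right_neutral symb_vf lscale_single)
qed simp

lemma vf_tmon_eq_0_iff [simp]: "vf (tmon \<alpha>) u = 0 \<longleftrightarrow> u = 0"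
  using vf_tmon_inject [of \<alpha> u 0] by (simp del: vf_tmon_inject)

lemma grad_eq_lscale_imp_single:
  assumes "generic v" "grad v p = lscale (pairing v \<alpha>) p"
  shows "p = Poly_Mapping.single \<alpha> (Poly_Mapping.lookup p \<alpha>)"
proof (rule poly_mapping_eqI)
  fix \<gamma>
  have "Poly_Mapping.lookup (grad v p) \<gamma> = Poly_Mapping.lookup (lscale (pairing v \<alpha>) p) \<gamma>"
    using assms(2) by simp
  then show "Poly_Mapping.lookup p \<gamma>
      = Poly_Mapping.lookup (Poly_Mapping.single \<alpha> (Poly_Mapping.lookup p \<alpha>)) \<gamma>"
    using assms(1) by (auto simp: generic_eq_iff lookup_single when_def)
qed

lemma grad_eq_0_imp_const:
  assumes "generic v" "grad v p = 0"
  shows "p = Poly_Mapping.single 0 (Poly_Mapping.lookup p 0)"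
  using grad_eq_lscale_imp_single [of v p 0] assms by simp

text \<open>On degree \<gamma> \<noteq> 0 the map \<open>ad d_v\<close> is multiplication by a
  nonzero scalar, so the degree-zero part of \<open>y\<close> is the only obstruction.\<close>

lemma exists_bracket_eq:
  assumes v: "generic v" and y: "\<And>\<gamma>. Poly_Mapping.lookup (symb y \<gamma>) 0 = 0"
  shows "\<exists>x. y = wbracket x (vf 1 v)"
proof -
  \<comment> \<open>At \<gamma> = 0 the division by zero yields 0, which agrees with the vanishing
    coefficient of \<open>y\<close> there.\<close>
  define p where "p i = Poly_Mapping.mapp (\<lambda>\<gamma> c. - c / pairing v \<gamma>) (symb y (axis i 1))" for i
  have "symb y (axis i 1) = - grad v (p i)" for i
  proof (rule poly_mapping_eqI)
    fix \<gamma>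
    show "Poly_Mapping.lookup (symb y (axis i 1)) \<gamma> = Poly_Mapping.lookup (- grad v (p i)) \<gamma>"
      using v y [of "axis i 1"]
      by (cases "\<gamma> = 0") (auto simp: p_def lookup_mapp when_def generic_def in_keys_iff)
  qed
  then show ?thesis
    by (intro exI [of _ "\<Sum>i\<in>UNIV. vf (p i) (axis i 1)"] witt_axis_eqI)
      (simp add: symb_bracket_cartan symb_sum_vf_axis)
qed

lemma witt_linear_eqI:
  fixes D E :: "'n::finite witt \<Rightarrow> 'n witt"
  assumes D: "Vector_Spaces.linear wscale wscale D" and E: "Vector_Spaces.linear wscale wscale E"
    and eq: "\<And>\<alpha> u. D (vf (tmon \<alpha>) u) = E (vf (tmon \<alpha>) u)"
  shows "D = E"
proof
  fix x
  have vf: "D (vf p u) = E (vf p u)" for p u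
  proof (induction p rule: laurent_induct)
    case zero
    have zero: "F 0 = 0" if "Vector_Spaces.linear wscale wscale F" for F :: "'n witt \<Rightarrow> 'n witt"
      using that unfolding witt_linear_iff by (metis add_cancel_right_right)
    then show ?case
      using zero [OF D] zero [OF E] by simp
  next
    case (single \<gamma> c)
    have "vf (Poly_Mapping.single \<gamma> c) u = wscale c (vf (tmon \<gamma>) u)"
      by (simp flip: vf_scale_left)
    then show ?case
      using D E eq by (simp add: witt_linear_iff)
  next
    case (add p q)
    then show ?case
      using D E by (simp add: vf_add_left witt_linear_iff)
  qed
  have "D (\<Sum>i\<in>I. vf (p i) (u i)) = E (\<Sum>i\<in>I. vf (p i) (u i))" for I :: "'n set" and p u
    using D E vf vf [of 0 0]
    by (induction I rule: infinite_finite_induct) (auto simp: witt_linear_iff)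
  then show "D x = E x"
    using witt_eq_sum_vf [of x] by metis
qed

lemma linear_eq_cartan_bracket:
  assumes "Vector_Spaces.linear wscale wscale D"
    and "\<And>\<alpha> u. D (vf (tmon \<alpha>) u) = wscale (c \<alpha>) (vf (tmon \<alpha>) u)"
    and "\<And>\<alpha> \<beta>. c (\<alpha> + \<beta>) = c \<alpha> + c \<beta>"
  shows "D = wbracket (vf 1 (\<chi> i. c (axis i 1)))"
proof (rule witt_linear_eqI)
  show "Vector_Spaces.linear wscale wscale (wbracket (vf 1 (\<chi> i. c (axis i 1))))"
    using derivation_wbracket unfolding witt.derivation_def by blast
  show "D (vf (tmon \<alpha>) u) = wbracket (vf 1 (\<chi> i. c (axis i 1))) (vf (tmon \<alpha>) u)" for \<alpha> u
    using additive_eq_pairing [of c \<alpha>] assms(2,3) by (simp add: vf_cartan_bracket)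
qed fact

lemma vec_linear_scalarI:
  fixes f :: "complex ^ 'n::finite \<Rightarrow> complex ^ 'n"
  assumes add: "\<And>u w. f (u + w) = f u + f w" and scale: "\<And>c u. f (c *s u) = c *s f u"
    and axis: "\<And>i. f (axis i 1) = a *s axis i 1"
  shows "f u = a *s u"
proof -
  interpret additive f
    by unfold_locales (rule add)
  have "f u = f (\<Sum>i\<in>UNIV. u $ i *s axis i 1)"
    by (simp add: basis_expansion)
  also have "\<dots> = (\<Sum>i\<in>UNIV. a *s (u $ i *s axis i 1))"
    unfolding sum scale axis by (simp add: vector_smult_assoc mult.commute)
  also have "\<dots> = a *s (\<Sum>i\<in>UNIV. u $ i *s axis i 1)"
    by (simp add: vec.scale_sum_right)
  finally show ?thesis
    by (simp add: basis_expansion)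
qed

text \<open>Apply \<open>D\<close> to \<open>[d_u, t^\<alpha> d_w] = \<langle>u, \<alpha>\<rangle>
  t^\<alpha> d_w\<close> and compare coefficients at \<open>t^\<alpha>\<close>. The contributions of
  \<open>D (t^\<alpha> d_w)\<close> on the two sides agree, and what is left is the constant term of
  \<open>symb (D d_u) \<alpha>\<close>.\<close>

lemma derivation_cartan_lookup_0:
  assumes D: "witt.derivation D"
  shows "Poly_Mapping.lookup (symb (D (vf 1 u)) \<alpha>) 0 = 0"
proof -
  define y where "y = D (vf 1 u)"
  fix i :: 'a
  define w :: "complex ^ 'a" where "w = axis i 1"
  define \<delta> :: "int ^ 'a" where "\<delta> = axis i 1"
  have w\<delta>: "pairing w \<delta> = 1"
    by (simp add: w_def \<delta>_def)
  define x where "x = D (vf (tmon \<alpha>) w)"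
  have "wscale (pairing u \<alpha>) x = wbracket y (vf (tmon \<alpha>) w) + wbracket (vf 1 u) x"
    using D vf_cartan_bracket [of u \<alpha> w] unfolding x_def y_def by (metis witt_derivation_iff)
  then have "Poly_Mapping.lookup (symb (wscale (pairing u \<alpha>) x) \<delta>) \<alpha>
      = Poly_Mapping.lookup (symb (wbracket y (vf (tmon \<alpha>) w) + wbracket (vf 1 u) x) \<delta>) \<alpha>"
    by simp
  then show ?thesis
    by (simp add: symb_wscale symb_add symb_bracket [of y] symb_cartan_bracket symb_vf w\<delta> act_tmon
        vf.rep_eq lookup_add lookup_minus lookup_tmon_mult flip: y_def)
qed

text \<open>As \<open>d_u\<close> commutes with \<open>d_v\<close> and \<open>D d_v = 0\<close>, the
  field \<open>D d_u\<close> commutes with \<open>d_v\<close> too, hence has degree zero; that part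
  vanishes by \<open>derivation_cartan_lookup_0\<close>.\<close>

lemma derivation_cartan_eq_0:
  assumes D: "witt.derivation D" and v: "generic v" and Dv: "D (vf 1 v) = 0"
  shows "D (vf 1 u) = 0"
proof (rule witt_symb_eqI)
  fix \<gamma>
  have "wbracket (vf 1 v) (vf 1 u) = 0"
    using vf_tmon_bracket [of 0 v 0 u] by simp
  moreover have "D 0 = 0"
    using D unfolding witt_derivation_iff by (metis add_cancel_right_right)
  ultimately have "wbracket (vf 1 v) (D (vf 1 u)) = 0"
    using D Dv by (simp add: witt_derivation_iff) (metis add_0 witt_bracket_zero(1))
  then have "grad v (symb (D (vf 1 u)) \<gamma>) = 0"
    by (metis symb_cartan_bracket symb_zero)
  from grad_eq_0_imp_const [OF v this] derivation_cartan_lookup_0 [OF D]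
  show "symb (D (vf 1 u)) \<gamma> = symb 0 \<gamma>"
    by (metis single_zero symb_zero)
qed

text \<open>\<open>D\<close> commutes with \<open>ad d_v\<close>, so it preserves the eigenspaces,
  which are the homogeneous components.\<close>

lemma derivation_vf_tmon:
  assumes D: "witt.derivation D" and v: "generic v" and Dv: "D (vf 1 v) = 0"
  shows "\<exists>w. D (vf (tmon \<alpha>) u) = vf (tmon \<alpha>) w"
proof -
  define x where "x = D (vf (tmon \<alpha>) u)"
  have "wscale (pairing v \<alpha>) x = D (wbracket (vf 1 v) (vf (tmon \<alpha>) u))"
    using D by (simp add: x_def vf_cartan_bracket witt_derivation_iff)
  also have "\<dots> = wbracket (vf 1 v) x"
    using D by (simp add: x_def witt_derivation_iff Dv)
  finally have "grad v (symb x \<gamma>) = lscale (pairing v \<alpha>) (symb x \<gamma>)" for \<gamma>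
    by (metis symb_cartan_bracket symb_wscale)
  then have "symb x \<gamma> = Poly_Mapping.single \<alpha> (Poly_Mapping.lookup (symb x \<gamma>) \<alpha>)" for \<gamma>
    using grad_eq_lscale_imp_single v by blast
  then have "x = vf (tmon \<alpha>) (\<chi> i. Poly_Mapping.lookup (symb x (axis i 1)) \<alpha>)"
    by (intro witt_axis_eqI) (simp add: symb_vf)
  then show ?thesis
    unfolding x_def by blast
qed

section \<open>Derivations that preserve the degree\<close>

definition integral_vec :: "int ^ 'n \<Rightarrow> complex ^ 'n"
  where "integral_vec m = (\<chi> i. of_int (m $ i))"

text \<open>Only integer vectors \<beta> are tested, and a generic \<open>v\<close> would have none
  but 0 in its kernel. For integral \<open>v\<close> the combination
  \<open>M \<alpha> *s \<gamma> - M \<gamma> *s \<alpha>\<close> is an integer kernel vector for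
  every \<gamma>.\<close>

lemma proportional_if_kernel_subset:
  fixes w :: "complex ^ 'n::finite" and m :: "int ^ 'n"
  defines "v \<equiv> integral_vec m"
  assumes \<alpha>: "pairing v \<alpha> \<noteq> 0" and ker: "\<And>\<beta>. pairing v \<beta> = 0 \<Longrightarrow> pairing w \<beta> = 0"
  shows "\<exists>c. w = c *s v"
proof -
  define M where "M \<gamma> = (\<Sum>i\<in>UNIV. m $ i * \<gamma> $ i)" for \<gamma>
  have M: "pairing v \<gamma> = of_int (M \<gamma>)" for \<gamma>
    by (simp add: pairing_def v_def M_def integral_vec_def)
  have "w = (pairing w \<alpha> / pairing v \<alpha>) *s v"
  proof (rule pairing_eqI)
    fix \<gamma>
    have "pairing w (M \<alpha> *s \<gamma> - M \<gamma> *s \<alpha>) = 0"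
      by (rule ker) (simp add: pairing_diff_right pairing_scale_right M)
    then show "pairing w \<gamma> = pairing ((pairing w \<alpha> / pairing v \<alpha>) *s v) \<gamma>"
      using \<alpha> by (simp add: pairing_diff_right pairing_scale_right pairing_scale_left M field_simps)
  qed
  then show ?thesis ..
qed

text \<open>The idea is that \<open>t^\<alpha> d_v\<close> and \<open>t^\<beta> d_u\<close> commute when \<open>u\<close> is orthogonal to \<open>\<alpha>\<close> and
  \<open>v\<close> to \<open>\<beta>\<close>; for \<open>n = 1\<close> there is no such \<open>u \<noteq> 0\<close>, but then \<open>\<beta> = 0\<close>.\<close>

lemma degree_zero_derivation_kernel:
  assumes D: "witt.derivation D"
    and \<phi>: "\<And>\<alpha> u. D (vf (tmon \<alpha>) u) = vf (tmon \<alpha>) (\<phi> \<alpha> u)"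
    and v: "pairing v \<alpha> \<noteq> 0" "pairing v \<beta> = 0"
  shows "pairing (\<phi> \<alpha> v) \<beta> = 0"
proof (cases "\<exists>u. u \<noteq> 0 \<and> pairing u \<alpha> = 0")
  case True
  then obtain u where u: "u \<noteq> 0" "pairing u \<alpha> = 0"
    by blast
  have "D 0 = 0"
    using D unfolding witt_derivation_iff by (metis add_cancel_right_right)
  moreover have "wbracket (vf (tmon \<alpha>) v) (vf (tmon \<beta>) u) = 0"
    by (simp add: vf_tmon_bracket u v)
  ultimately have "wbracket (D (vf (tmon \<alpha>) v)) (vf (tmon \<beta>) u)
      + wbracket (vf (tmon \<alpha>) v) (D (vf (tmon \<beta>) u)) = 0"
    using D by (metis witt_derivation_iff)
  then have "pairing (\<phi> \<alpha> v) \<beta> *s u - pairing (\<phi> \<beta> u) \<alpha> *s v = 0"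
    by (simp add: \<phi> vf_tmon_bracket u v flip: vf_add_right)
  then have eq: "pairing (\<phi> \<alpha> v) \<beta> *s u = pairing (\<phi> \<beta> u) \<alpha> *s v"
    by simp
  \<comment> \<open>Pairing with \<alpha> kills the side of \<open>u\<close>; as
    \<open>pairing v \<alpha> \<noteq> 0\<close>, both coefficients vanish.\<close>
  then have "pairing (\<phi> \<beta> u) \<alpha> * pairing v \<alpha> = 0"
    using u by (metis mult_zero_right pairing_scale_left)
  then show ?thesis
    using v u eq by simp
next
  case False
  obtain j where j: "\<alpha> $ j \<noteq> 0"
    using v(1) by (metis pairing_zero(1) vec_eq_iff zero_index)
  have only: "k = j" for k
  proof (rule ccontr)
    assume "k \<noteq> j"
    define u :: "complex ^ 'a"
      where "u = of_int (\<alpha> $ k) *s axis j 1 - of_int (\<alpha> $ j) *s axis k 1"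
    have "pairing u \<alpha> = 0"
      by (simp add: u_def pairing_diff_left pairing_scale_left)
    moreover have "u $ k \<noteq> 0"
      using j \<open>k \<noteq> j\<close> by (simp add: u_def axis_def)
    ultimately show False
      using False by (metis zero_index)
  qed
  then have UNIV: "UNIV = {j}"
    by auto
  have "pairing v \<gamma> = v $ j * of_int (\<gamma> $ j)" for \<gamma>
    unfolding pairing_def UNIV by simp
  then have "\<beta> $ j = 0"
    using v by auto
  then have "\<beta> = 0"
    using only by (metis vec_eq_iff zero_index)
  then show ?thesis
    by simp
qed

text \<open>By the two preceding lemmas, every integral vector not orthogonal to \<alpha> is an
  eigenvector of \<open>\<phi> \<alpha>\<close>. There are enough of these to force a single
  eigenvalue.\<close>

lemma degree_zero_derivation_scalar:
  assumes D: "witt.derivation D"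
    and \<phi>: "\<And>\<alpha> u. D (vf (tmon \<alpha>) u) = vf (tmon \<alpha>) (\<phi> \<alpha> u)"
    and "\<alpha> \<noteq> 0"
  shows "\<exists>c. \<forall>u. \<phi> \<alpha> u = c *s u"
proof -
  have add: "\<phi> \<alpha> (u + w) = \<phi> \<alpha> u + \<phi> \<alpha> w" for u w
  proof -
    have "vf (tmon \<alpha>) (\<phi> \<alpha> (u + w)) = vf (tmon \<alpha>) (\<phi> \<alpha> u + \<phi> \<alpha> w)"
      using D by (simp add: vf_add_right witt_derivation_iff flip: \<phi>)
    then show ?thesis
      by simp
  qed
  have scale: "\<phi> \<alpha> (c *s u) = c *s \<phi> \<alpha> u" for c u
  proof -
    have "vf (tmon \<alpha>) (\<phi> \<alpha> (c *s u)) = vf (tmon \<alpha>) (c *s \<phi> \<alpha> u)"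
      using D by (simp add: vf_scale_right witt_derivation_iff flip: \<phi>)
    then show ?thesis
      by simp
  qed
  have eigen: "\<exists>c. \<phi> \<alpha> (integral_vec m) = c *s integral_vec m"
    if "pairing (integral_vec m) \<alpha> \<noteq> 0" for m
    using that degree_zero_derivation_kernel [OF D \<phi>]
    by (intro proportional_if_kernel_subset) blast+
  obtain j where j: "\<alpha> $ j \<noteq> 0"
    using \<open>\<alpha> \<noteq> 0\<close> by (metis vec_eq_iff zero_index)
  have axis_int: "axis i 1 = integral_vec (axis i 1)" for i
    by (simp add: integral_vec_def axis_def vec_eq_iff)
  obtain c where c: "\<phi> \<alpha> (axis j 1) = c *s axis j 1"
    using eigen [of "axis j 1"] j unfolding axis_int [symmetric] by auto
  have "\<phi> \<alpha> (axis i 1) = c *s axis i 1" for i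
  proof (cases "i = j")
    case False
    \<comment> \<open>Being larger than the absolute value of \<open>\<alpha> $ j\<close>, which is
      nonzero, \<open>s\<close> does not divide \<open>\<alpha> $ j\<close>. So neither
      \<open>e_j + s e_i\<close> nor \<open>e_j - s e_i\<close> is orthogonal to \<alpha>, and both
      are eigenvectors.\<close>
    define s :: int where "s = \<bar>\<alpha> $ j\<bar> + 1"
    have s: "\<alpha> $ j + s * \<alpha> $ i \<noteq> 0" "\<alpha> $ j - s * \<alpha> $ i \<noteq> 0"
    proof -
      have "\<not> s dvd \<alpha> $ j"
        using j dvd_imp_le_int [of "\<alpha> $ j" s] by (auto simp: s_def)
      then show "\<alpha> $ j + s * \<alpha> $ i \<noteq> 0" "\<alpha> $ j - s * \<alpha> $ i \<noteq> 0"
        by (metis add_eq_0_iff2 dvd_triv_left dvd_minus_iff minus_mult_right right_minus_eq)+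
    qed
    let ?v = "axis j 1 :: complex ^ 'a" and ?w = "of_int s *s axis i 1 :: complex ^ 'a"
    have plus: "?v + ?w = integral_vec (axis j 1 + s *s axis i 1)"
      and minus: "?v - ?w = integral_vec (axis j 1 - s *s axis i 1)"
      by (simp_all add: integral_vec_def axis_def vec_eq_iff)
    have "pairing (?v + ?w) \<alpha> = of_int (\<alpha> $ j + s * \<alpha> $ i)"
      "pairing (?v - ?w) \<alpha> = of_int (\<alpha> $ j - s * \<alpha> $ i)"
      by (simp_all add: pairing_add_left pairing_diff_left pairing_scale_left)
    then obtain a b where a: "\<phi> \<alpha> (?v + ?w) = a *s (?v + ?w)" and b: "\<phi> \<alpha> (?v - ?w) = b *s (?v - ?w)"
      using s eigen unfolding plus minus by (metis of_int_eq_0_iff)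
    \<comment> \<open>The two eigenvectors add up to \<open>2 e_j\<close>, whose eigenvalue is c;
      coordinates j and i give a = b = c.\<close>
    have "a *s (?v + ?w) + b *s (?v - ?w) = \<phi> \<alpha> ((?v + ?w) + (?v - ?w))"
      unfolding add [of "?v + ?w" "?v - ?w"] a b ..
    also have "(?v + ?w) + (?v - ?w) = 2 *s ?v"
      by (simp add: vec_eq_iff)
    also have "\<phi> \<alpha> (2 *s ?v) = 2 *s (c *s ?v)"
      by (simp only: scale c)
    finally have "(a *s (?v + ?w) + b *s (?v - ?w)) $ k = (2 *s (c *s ?v)) $ k" for k
      by simp
    from this [of j] this [of i] have "a + b = 2 * c" "a * of_int s = b * of_int s"
      using False by (simp_all add: axis_def)
    moreover have s0: "of_int s \<noteq> (0 :: complex)"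
      unfolding of_int_eq_0_iff by (simp add: s_def)
    ultimately have "a = c"
      by simp
    then have "c *s ?v + of_int s *s \<phi> \<alpha> (axis i 1) = c *s ?v + of_int s *s (c *s axis i 1)"
      using a by (simp add: add c scale vec.scale_right_distrib vector_smult_assoc mult.commute)
    then show ?thesis
      by (metis add_left_imp_eq s0 vec.scale_left_imp_eq)
  qed (simp add: c)
  then show ?thesis
    using vec_linear_scalarI [of "\<phi> \<alpha>" c] add scale by blast
qed

text \<open>\<open>D\<close> multiplies \<open>t^\<alpha> d_u\<close> by a scalar
  \<open>c \<alpha>\<close>. Applying \<open>D\<close> to the bracket of
  \<open>t^\<alpha> d_v\<close> and \<open>t^\<beta> d_v\<close>, nonzero for \<alpha> \<noteq>
  \<beta> by genericity, shows that \<open>c\<close> is additive, so \<open>D\<close> is the bracket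
  with a Cartan element.\<close>

lemma degree_zero_derivation_inner:
  assumes D: "witt.derivation D" and v: "generic v" and Dv: "D (vf 1 v) = 0"
  shows "\<exists>x. D = wbracket x"
proof -
  obtain \<phi> where \<phi>: "\<And>\<alpha> u. D (vf (tmon \<alpha>) u) = vf (tmon \<alpha>) (\<phi> \<alpha> u)"
    using derivation_vf_tmon [OF D v Dv] by metis
  have "\<phi> 0 u = 0" for u
    using \<phi> [of 0 u] derivation_cartan_eq_0 [OF D v Dv, of u] vf_tmon_eq_0_iff [of 0 "\<phi> 0 u"] by simp
  then have "\<exists>c. \<forall>u. \<phi> \<alpha> u = c *s u" for \<alpha>
    using degree_zero_derivation_scalar [OF D \<phi>, of \<alpha>] by (cases "\<alpha> = 0") auto
  then obtain c where c: "\<And>\<alpha> u. \<phi> \<alpha> u = c \<alpha> *s u"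
    by metis
  have Dc: "D (vf (tmon \<alpha>) u) = wscale (c \<alpha>) (vf (tmon \<alpha>) u)" for \<alpha> u
    by (simp only: \<phi> c vf_scale_right)
  have v0: "v \<noteq> 0"
    using generic_nonzero [OF v] by (metis zero_index)
  have c0: "c 0 = 0"
    using \<open>\<phi> 0 v = 0\<close> v0 by (simp add: c)
  have c_add: "c (\<alpha> + \<beta>) = c \<alpha> + c \<beta>" if "\<alpha> \<noteq> \<beta>" for \<alpha> \<beta>
  proof -
    define x where "x = wbracket (vf (tmon \<alpha>) v) (vf (tmon \<beta>) v)"
    have x: "x = vf (tmon (\<alpha> + \<beta>)) ((pairing v \<beta> - pairing v \<alpha>) *s v)"
      by (simp add: x_def vf_tmon_bracket vec.scale_left_diff_distrib)
    have "x \<noteq> 0"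
      using v v0 that by (simp add: x generic_eq_iff)
    have "wscale (c (\<alpha> + \<beta>)) x = D x"
      by (simp only: x Dc)
    also have "\<dots> = wbracket (D (vf (tmon \<alpha>) v)) (vf (tmon \<beta>) v)
        + wbracket (vf (tmon \<alpha>) v) (D (vf (tmon \<beta>) v))"
      using D unfolding x_def witt_derivation_iff by blast
    also have "\<dots> = wscale (c \<alpha> + c \<beta>) x"
      by (simp only: Dc x_def witt.bracket_scale_left witt.bracket_scale_right witt.scale_left_distrib)
    finally show ?thesis
      using \<open>x \<noteq> 0\<close> by (simp only: witt.scale_right_imp_eq)
  qed
  \<comment> \<open>The bracket is zero for equal exponents, so this case goes through -\<alpha>,
    which differs from \<alpha> and from 2\<alpha> when \<alpha> \<noteq> 0.\<close>
  have "c (\<alpha> + \<alpha>) = c \<alpha> + c \<alpha>" for \<alpha>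
  proof (cases "\<alpha> = 0")
    case False
    have "\<alpha> \<noteq> - \<alpha>" "\<alpha> + \<alpha> \<noteq> - \<alpha>"
      using False by (auto simp: vec_eq_iff)
    then have "c (\<alpha> + - \<alpha>) = c \<alpha> + c (- \<alpha>)" "c (\<alpha> + \<alpha> + - \<alpha>) = c (\<alpha> + \<alpha>) + c (- \<alpha>)"
      by (metis c_add)+
    then show ?thesis
      using c0 by (simp add: eq_neg_iff_add_eq_0 [symmetric])
  qed (simp add: c0)
  then have "c (\<alpha> + \<beta>) = c \<alpha> + c \<beta>" for \<alpha> \<beta>
    using c_add by (cases "\<alpha> = \<beta>") auto
  then show ?thesis
    using linear_eq_cartan_bracket [of D c] D Dc unfolding witt.derivation_def by blast
qed

lemma derivation_inner:
  assumes D: "witt.derivation (D :: 'n::finite witt \<Rightarrow> 'n witt)"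
  shows "\<exists>x. D = wbracket x"
proof -
  obtain v :: "complex ^ 'n" where v: "generic v"
    using exists_real_generic by blast
  obtain x where x: "D (vf 1 v) = wbracket x (vf 1 v)"
    using exists_bracket_eq [OF v] derivation_cartan_lookup_0 [OF D] by blast
  define E where "E z = D z - wbracket x z" for z
  have "witt.derivation E" "E (vf 1 v) = 0"
    using derivation_diff [OF D derivation_wbracket] x by (simp_all add: E_def [abs_def])
  then obtain y where "E = wbracket y"
    using degree_zero_derivation_inner v by blast
  then have "D z = wbracket (x + y) z" for z
    by (simp add: witt.bracket_add_left E_def fun_eq_iff algebra_simps)
  then show ?thesis
    by blast
qed

section \<open>Local derivations\<close>

lemma local_derivation_iff:
  "witt.local_derivation \<Delta> \<longleftrightarrow>
    Vector_Spaces.linear wscale wscale \<Delta> \<and> (\<forall>x. \<exists>y. \<Delta> x = wbracket y x)"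
  unfolding witt.local_derivation_def using derivation_inner derivation_wbracket by metis

lemma local_derivation_diff_bracket:
  assumes "witt.local_derivation \<Delta>"
  shows "witt.local_derivation (\<lambda>z. \<Delta> z - wbracket x z)"
  unfolding local_derivation_iff
proof
  show "Vector_Spaces.linear wscale wscale (\<lambda>z. \<Delta> z - wbracket x z)"
    using assms
    by (simp add: local_derivation_iff witt_linear_iff witt.bracket_add_right
        witt.bracket_scale_right witt.scale_right_diff_distrib)
  show "\<forall>z. \<exists>y. \<Delta> z - wbracket x z = wbracket y z"
    using assms unfolding local_derivation_iff by (metis witt_bracket_diff_left)
qed

lemma local_derivation_cartan_eq_0:
  assumes \<Delta>: "witt.local_derivation \<Delta>" and v: "generic v" and \<Delta>v: "\<Delta> (vf 1 v) = 0"
  shows "\<Delta> (vf 1 u) = 0"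
proof -
  have ker: "Poly_Mapping.lookup (symb (\<Delta> (vf 1 w)) \<gamma>) \<alpha> = 0" if w: "pairing w \<alpha> = 0" for w \<gamma> \<alpha>
  proof -
    obtain y where "\<Delta> (vf 1 w) = wbracket y (vf 1 w)"
      using \<Delta> unfolding local_derivation_iff by blast
    then show ?thesis
      by (simp add: symb_bracket_cartan w)
  qed
  have "Poly_Mapping.lookup (symb (\<Delta> (vf 1 u)) \<gamma>) \<alpha> = 0" for \<gamma> \<alpha>
  proof (cases "\<alpha> = 0")
    case False
    \<comment> \<open>Chosen to make \<open>u - k *s v\<close> orthogonal to \<alpha>; the remaining
      multiple of \<open>d_v\<close> is killed by \<Delta>.\<close>
    define k where "k = pairing u \<alpha> / pairing v \<alpha>"
    have "pairing (u - k *s v) \<alpha> = 0"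
      using v False by (auto simp: k_def pairing_diff_left pairing_scale_left generic_def)
    moreover have "\<Delta> (vf 1 (u - k *s v)) + wscale k (\<Delta> (vf 1 v)) = \<Delta> (vf 1 u)"
      using \<Delta> unfolding local_derivation_iff witt_linear_iff
      by (metis diff_add_cancel vf_add_right vf_scale_right)
    then have "\<Delta> (vf 1 (u - k *s v)) = \<Delta> (vf 1 u)"
      by (simp add: \<Delta>v)
    ultimately show ?thesis
      using ker by metis
  qed (simp add: ker)
  then show ?thesis
    by (intro witt_symb_eqI poly_mapping_eqI) simp
qed

text \<open>The witness \<open>x\<close> depends on \<open>s\<close> but not on \<gamma>. The last
  term vanishes at torus points where \<open>t^\<alpha>\<close> takes the value
  \<open>s\<close>.\<close>

lemma local_derivation_tmon_symb:
  assumes \<Delta>: "witt.local_derivation \<Delta>" and \<Delta>0: "\<And>u. \<Delta> (vf 1 u) = 0"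
  shows "\<exists>x. \<forall>\<gamma>. symb (\<Delta> (vf (tmon \<alpha>) u)) \<gamma>
    = lscale (pairing u \<gamma>) (tmon \<alpha> * symb x \<alpha>)
      - (tmon \<alpha> - Poly_Mapping.single 0 s) * grad u (symb x \<gamma>)"
proof -
  let ?p = "tmon \<alpha> - Poly_Mapping.single 0 s"
  have "vf ?p u + wscale s (vf 1 u) = vf (tmon \<alpha>) u"
    by (simp flip: vf_scale_left vf_add_left single_one)
  then have "\<Delta> (vf (tmon \<alpha>) u) = \<Delta> (vf ?p u) + wscale s (\<Delta> (vf 1 u))"
    using \<Delta> unfolding local_derivation_iff witt_linear_iff by metis
  moreover obtain x where "\<Delta> (vf ?p u) = wbracket x (vf ?p u)"
    using \<Delta> unfolding local_derivation_iff by blast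
  ultimately have "\<Delta> (vf (tmon \<alpha>) u) = wbracket x (vf ?p u)"
    by (simp add: \<Delta>0)
  then show ?thesis
    by (intro exI [of _ x]) (simp add: symb_bracket symb_vf act_scale act_diff act_tmon vf.rep_eq)
qed

text \<open>At a point \<rho>, with \<open>s = \<rho> \<alpha>\<close>, the symbol at \<gamma>
  becomes \<open>pairing u \<gamma>\<close> times a factor independent of \<gamma>.
  Cross-multiplying eliminates the witness, which varies with \<rho>, so the identity holds at all
  points.\<close>

lemma local_derivation_tmon_proportional:
  assumes \<Delta>: "witt.local_derivation \<Delta>" and \<Delta>0: "\<And>u. \<Delta> (vf 1 u) = 0"
  shows "lscale (pairing u \<delta>) (symb (\<Delta> (vf (tmon \<alpha>) u)) \<gamma>)
    = lscale (pairing u \<gamma>) (symb (\<Delta> (vf (tmon \<alpha>) u)) \<delta>)"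
proof -
  let ?y = "\<Delta> (vf (tmon \<alpha>) u)"
  have "lscale (pairing u \<delta>) (symb ?y \<gamma>) - lscale (pairing u \<gamma>) (symb ?y \<delta>) = 0"
  proof (rule laurent_eval_eq_0_imp_eq_0)
    fix \<rho> :: "int ^ 'a \<Rightarrow> complex"
    assume \<rho>: "character \<rho>"
    obtain x where x: "\<And>\<gamma>. symb ?y \<gamma> = lscale (pairing u \<gamma>) (tmon \<alpha> * symb x \<alpha>)
        - (tmon \<alpha> - Poly_Mapping.single 0 (\<rho> \<alpha>)) * grad u (symb x \<gamma>)"
      using local_derivation_tmon_symb [OF \<Delta> \<Delta>0] by blast
    have "laurent_eval \<rho> (tmon \<alpha> - Poly_Mapping.single 0 (\<rho> \<alpha>)) = 0"
      using \<rho> by (simp add: laurent_eval_diff character_def)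
    then have "laurent_eval \<rho> (symb ?y \<gamma>) = pairing u \<gamma> * laurent_eval \<rho> (tmon \<alpha> * symb x \<alpha>)" for \<gamma>
      unfolding x by (simp add: laurent_eval_diff laurent_eval_mult [OF \<rho>] laurent_eval_lscale)
    then show "laurent_eval \<rho> (lscale (pairing u \<delta>) (symb ?y \<gamma>) - lscale (pairing u \<gamma>) (symb ?y \<delta>)) = 0"
      by (simp add: laurent_eval_diff laurent_eval_lscale)
  qed
  then show ?thesis
    by simp
qed

text \<open>First-order information at \<rho> is used here. Writing \<open>r = a (symb x \<alpha>) -
  (1 - \<rho>(\<alpha>) t^(-\<alpha>)) g\<close>, where \<open>g = d_v (symb x \<alpha>)\<close>,
  the derivative \<open>d_v r\<close> has value \<open>a g - a g = 0\<close> at \<rho>. Hence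
  \<open>d_v r = 0\<close>, and \<open>r\<close> is constant by genericity.\<close>

lemma local_derivation_tmon_generic:
  assumes \<Delta>: "witt.local_derivation \<Delta>" and \<Delta>0: "\<And>u. \<Delta> (vf 1 u) = 0"
    and v: "generic v" and \<alpha>: "\<alpha> \<noteq> 0"
  shows "\<exists>c. \<Delta> (vf (tmon \<alpha>) v) = wscale c (vf (tmon \<alpha>) v)"
proof -
  let ?y = "\<Delta> (vf (tmon \<alpha>) v)"
  define r where "r = tmon (- \<alpha>) * symb ?y \<alpha>"
  define a where "a = pairing v \<alpha>"
  have "a \<noteq> 0"
    using v \<alpha> by (auto simp: a_def generic_def)
  have "grad v r = 0"
  proof (rule laurent_eval_eq_0_imp_eq_0)
    fix \<rho> :: "int ^ 'a \<Rightarrow> complex"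
    assume \<rho>: "character \<rho>"
    then have inv: "\<rho> \<alpha> * \<rho> (- \<alpha>) = 1"
      unfolding character_def by (metis add.right_inverse)
    obtain x where x: "\<And>\<gamma>. symb ?y \<gamma> = lscale (pairing v \<gamma>) (tmon \<alpha> * symb x \<alpha>)
        - (tmon \<alpha> - Poly_Mapping.single 0 (\<rho> \<alpha>)) * grad v (symb x \<gamma>)"
      using local_derivation_tmon_symb [OF \<Delta> \<Delta>0] by blast
    define g where "g = grad v (symb x \<alpha>)"
    have "r = lscale a (symb x \<alpha>) - (1 - Poly_Mapping.single (- \<alpha>) (\<rho> \<alpha>)) * g"
      unfolding r_def x a_def g_def
      by (simp add: right_diff_distrib left_diff_distrib lscale_mult_right mult_single
          flip: mult.assoc [of "tmon (- \<alpha>)"])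
    then have "grad v r = lscale a g
        - (Poly_Mapping.single (- \<alpha>) (a * \<rho> \<alpha>) * g
          + (1 - Poly_Mapping.single (- \<alpha>) (\<rho> \<alpha>)) * grad v g)"
      by (simp add: grad_diff grad_lscale grad_mult grad_single g_def a_def pairing_minus_right
          single_uminus flip: single_one)
    moreover have "laurent_eval \<rho> 1 = 1"
      using \<rho> laurent_eval_single [of \<rho> 0 1] by (simp add: character_def)
    ultimately show "laurent_eval \<rho> (grad v r) = 0"
      using inv
      by (simp add: laurent_eval_diff laurent_eval_add laurent_eval_lscale laurent_eval_mult [OF \<rho>])
  qed
  then obtain b where "r = Poly_Mapping.single 0 b"
    using grad_eq_0_imp_const v by blast
  then have y\<alpha>: "symb ?y \<alpha> = lscale b (tmon \<alpha>)"
    using tmon_cancel(1) [of \<alpha> "symb ?y \<alpha>"] by (simp add: r_def mult_single)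
  have "symb ?y \<gamma> = symb (wscale (b / a) (vf (tmon \<alpha>) v)) \<gamma>" for \<gamma>
  proof -
    have "lscale (1 / a) (lscale a (symb ?y \<gamma>)) = lscale (1 / a) (lscale (pairing v \<gamma>) (symb ?y \<alpha>))"
      using local_derivation_tmon_proportional [OF \<Delta> \<Delta>0] unfolding a_def by simp
    then show ?thesis
      using \<open>a \<noteq> 0\<close> by (simp add: y\<alpha> symb_wscale symb_vf mult.commute)
  qed
  then show ?thesis
    using witt_symb_eqI by blast
qed

text \<open>Proportionality makes \<open>\<Delta> (t^\<alpha> d_i)\<close> a multiple
  \<open>p_i d_i\<close>. By linearity the symbol of \<open>\<Delta> (t^\<alpha> d_v)\<close> at
  \<open>e_j\<close> is \<open>v_j p_j\<close>; since each \<open>v_j\<close> is nonzero, the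
  eigenvalue for \<open>v\<close> determines every \<open>p_j\<close>.\<close>

lemma local_derivation_tmon_scalar:
  assumes \<Delta>: "witt.local_derivation \<Delta>" and \<Delta>0: "\<And>u. \<Delta> (vf 1 u) = 0" and \<alpha>: "\<alpha> \<noteq> 0"
  shows "\<exists>c. \<forall>u. \<Delta> (vf (tmon \<alpha>) u) = wscale c (vf (tmon \<alpha>) u)"
proof -
  obtain v :: "complex ^ 'a" where v: "generic v"
    using exists_real_generic by blast
  obtain c where c: "\<Delta> (vf (tmon \<alpha>) v) = wscale c (vf (tmon \<alpha>) v)"
    using local_derivation_tmon_generic [OF \<Delta> \<Delta>0 v \<alpha>] by blast
  define p where "p i = symb (\<Delta> (vf (tmon \<alpha>) (axis i 1))) (axis i 1)" for i
  have axis: "\<Delta> (vf (tmon \<alpha>) (axis i 1)) = vf (p i) (axis i 1)" for i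
  proof (rule witt_symb_eqI)
    show "symb (\<Delta> (vf (tmon \<alpha>) (axis i 1))) \<gamma> = symb (vf (p i) (axis i 1)) \<gamma>" for \<gamma>
      using local_derivation_tmon_proportional [OF \<Delta> \<Delta>0, of "axis i 1" "axis i 1" \<alpha> \<gamma>]
      by (simp add: p_def symb_vf)
  qed
  interpret additive "\<lambda>u. \<Delta> (vf (tmon \<alpha>) u)"
    using \<Delta> by unfold_locales (simp add: local_derivation_iff witt_linear_iff vf_add_right)
  have expand: "symb (\<Delta> (vf (tmon \<alpha>) u)) (axis j 1) = lscale (u $ j) (p j)" for u j
  proof -
    have "\<Delta> (vf (tmon \<alpha>) u) = \<Delta> (vf (tmon \<alpha>) (\<Sum>i\<in>UNIV. u $ i *s axis i 1))"
      by (simp add: basis_expansion)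
    also have "\<dots> = (\<Sum>i\<in>UNIV. vf (lscale (u $ i) (p i)) (axis i 1))"
      unfolding sum using \<Delta>
      by (simp add: local_derivation_iff witt_linear_iff vf_scale_right axis vf_scale_left)
    finally show ?thesis
      by (simp add: symb_sum_vf_axis)
  qed
  have "p j = lscale c (tmon \<alpha>)" for j
  proof -
    have "lscale (1 / v $ j) (lscale (v $ j) (p j)) = lscale (1 / v $ j) (lscale (c * v $ j) (tmon \<alpha>))"
      unfolding expand [symmetric] c by (simp add: symb_wscale symb_vf)
    then show ?thesis
      using generic_nonzero [OF v, of j] by simp
  qed
  then have "\<Delta> (vf (tmon \<alpha>) u) = wscale c (vf (tmon \<alpha>) u)" for u
    by (intro witt_axis_eqI) (simp add: expand symb_wscale symb_vf mult.commute)
  then show ?thesis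
    by blast
qed

lemma local_derivation_second_difference:
  assumes \<Delta>: "witt.local_derivation \<Delta>"
    and c: "\<And>\<alpha> u. \<Delta> (vf (tmon \<alpha>) u) = wscale (c \<alpha>) (vf (tmon \<alpha>) u)"
  shows "c (\<alpha> + (\<beta> + \<beta>)) - 2 * c (\<alpha> + \<beta>) + c \<alpha> = 0"
proof -
  fix i :: 'a
  define v :: "complex ^ 'a" where "v = axis i 1"
  define \<delta> :: "int ^ 'a" where "\<delta> = axis i 1"
  have v\<delta>: "pairing v \<delta> = 1"
    by (simp add: v_def \<delta>_def)
  \<comment> \<open>The constant character 1 is the identity of the torus.\<close>
  define \<rho> :: "int ^ 'a \<Rightarrow> complex" where "\<rho> = (\<lambda>_. 1)"
  have \<rho>: "character \<rho>"
    by (simp add: \<rho>_def character_def)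
  define b where "b = tmon \<beta> - 1"
  define p where "p = tmon \<alpha> * (b * b)"
  have b: "laurent_eval \<rho> b = 0"
    by (simp add: b_def laurent_eval_diff \<rho>_def flip: single_one)
  have p: "p = tmon (\<alpha> + (\<beta> + \<beta>)) - lscale 2 (tmon (\<alpha> + \<beta>)) + tmon \<alpha>"
  proof -
    have "b * b = tmon (\<beta> + \<beta>) - lscale 2 (tmon \<beta>) + 1"
      by (simp add: b_def algebra_simps single_add [symmetric])
    then show ?thesis
      by (simp add: p_def distrib_left right_diff_distrib mult_single)
  qed
  have lin: "\<Delta> (x + y) = \<Delta> x + \<Delta> y" "\<Delta> (wscale k x) = wscale k (\<Delta> x)" for x y k
    using \<Delta> by (simp_all add: local_derivation_iff witt_linear_iff)
  have diff: "\<Delta> (x - y) = \<Delta> x - \<Delta> y" for x y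
    using lin(1) [of "x - y" y] by simp
  have "symb (\<Delta> (vf p v)) \<delta> = lscale (c (\<alpha> + (\<beta> + \<beta>))) (tmon (\<alpha> + (\<beta> + \<beta>)))
      - lscale (2 * c (\<alpha> + \<beta>)) (tmon (\<alpha> + \<beta>)) + lscale (c \<alpha>) (tmon \<alpha>)"
    unfolding p vf_add_left vf_diff_left vf_scale_left lin diff c
    by (simp only: symb_add symb_diff symb_wscale symb_vf v\<delta> lscale_lscale mult_1_right)
  then have "laurent_eval \<rho> (symb (\<Delta> (vf p v)) \<delta>)
      = c (\<alpha> + (\<beta> + \<beta>)) - 2 * c (\<alpha> + \<beta>) + c \<alpha>"
    by (simp add: laurent_eval_add laurent_eval_diff \<rho>_def)
  moreover obtain x where "\<Delta> (vf p v) = wbracket x (vf p v)"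
    using \<Delta> unfolding local_derivation_iff by blast
  then have "symb (\<Delta> (vf p v)) \<delta> = act x p - p * grad v (symb x \<delta>)"
    by (simp add: symb_bracket symb_vf v\<delta> vf.rep_eq)
  \<comment> \<open>By the Leibniz rule every term of \<open>act x p\<close> retains a factor
    \<open>b\<close>, which vanishes at \<rho>.\<close>
  then have "laurent_eval \<rho> (symb (\<Delta> (vf p v)) \<delta>) = 0"
    by (simp add: p_def act_mult laurent_eval_diff laurent_eval_add laurent_eval_mult [OF \<rho>] b)
  ultimately show ?thesis
    by simp
qed

theorem theorem3p1:
  fixes \<Delta> :: "'n::finite witt \<Rightarrow> 'n witt"
  assumes "witt.local_derivation \<Delta>"
  shows "witt.derivation \<Delta>"
proof -
  obtain v :: "complex ^ 'n" where v: "generic v"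
    using exists_real_generic by blast
  obtain x where x: "\<Delta> (vf 1 v) = wbracket x (vf 1 v)"
    using assms unfolding local_derivation_iff by blast
  define E where "E z = \<Delta> z - wbracket x z" for z
  have E: "witt.local_derivation E"
    using local_derivation_diff_bracket [OF assms] by (simp add: E_def [abs_def])
  have "E (vf 1 v) = 0"
    by (simp add: E_def x)
  then have E0: "E (vf 1 u) = 0" for u
    using local_derivation_cartan_eq_0 [OF E v] by blast
  have "\<exists>c. \<forall>u. E (vf (tmon \<alpha>) u) = wscale c (vf (tmon \<alpha>) u)" for \<alpha>
  proof (cases "\<alpha> = 0")
    case True
    then show ?thesis
      by (intro exI [of _ 0]) (simp add: E0)
  qed (use local_derivation_tmon_scalar [OF E E0] in blast)
  then obtain c where c: "\<And>\<alpha> u. E (vf (tmon \<alpha>) u) = wscale (c \<alpha>) (vf (tmon \<alpha>) u)"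
    by metis
  have "v \<noteq> 0"
    using generic_nonzero [OF v] by (metis zero_index)
  then have c0: "c 0 = 0"
    using c [of 0 v] E0 [of v] vf_tmon_eq_0_iff [of 0 v] by simp
  have diff2: "c (\<alpha> + (\<beta> + \<beta>)) = 2 * c (\<alpha> + \<beta>) - c \<alpha>" for \<alpha> \<beta>
    using local_derivation_second_difference [OF E c, of \<alpha> \<beta>] by (simp add: algebra_simps)
  have double: "c (\<beta> + \<beta>) = 2 * c \<beta>" for \<beta>
    using diff2 [of 0 \<beta>] by (simp add: c0)
  have "c (\<alpha> + \<beta>) = c \<alpha> + c \<beta>" for \<alpha> \<beta>
  proof -
    \<comment> \<open>The second difference with base 2\<alpha> and step \<beta> - \<alpha> passes
      through 2\<alpha>, \<alpha> + \<beta> and 2\<beta>; doubling then turns it into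
      additivity.\<close>
    have "(\<alpha> + \<alpha>) + ((\<beta> - \<alpha>) + (\<beta> - \<alpha>)) = \<beta> + \<beta>" "(\<alpha> + \<alpha>) + (\<beta> - \<alpha>) = \<alpha> + \<beta>"
      by simp_all
    then have "c (\<beta> + \<beta>) = 2 * c (\<alpha> + \<beta>) - c (\<alpha> + \<alpha>)"
      using diff2 [of "\<alpha> + \<alpha>" "\<beta> - \<alpha>"] by metis
    then have "2 * c (\<alpha> + \<beta>) = 2 * (c \<alpha> + c \<beta>)"
      unfolding double by (simp add: algebra_simps)
    then show ?thesis
      by (metis mult_left_cancel zero_neq_numeral)
  qed
  then obtain w where "E = wbracket w"
    using linear_eq_cartan_bracket [OF _ c] E unfolding local_derivation_iff by blast
  then have "\<Delta> = wbracket (x + w)"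
    by (simp add: fun_eq_iff E_def witt.bracket_add_left algebra_simps)
  then show ?thesis
    using derivation_wbracket by simp
qed

end
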